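(* Let $(X,d)$ be a complete dislocated metric space and let $\{f_n\}_{n=1}^{\infty}$ be a sequence of self-mappings on $X$. Suppose that there exists $\alpha\in\mathcal{A}_d$ such that \[ d(f_i x,f_j y)\le \alpha\bigl(d(x,y),d(x,f_i x),d(y,f_j y)\bigr) \] for all $x,y\in X$ and all $i,j\in\mathbb{N}$ (with $\mathbb{N}=\{1,2,\dots\}$). Then $\{f_n\}_{n=1}^{\infty}$ has a unique common fixed point $z\in X$ (that is, there is a unique $z\in X$ with $f_n z=z$ for all $n\ge 1$), and $d(z,z)=0$.
   Context: Write $\mathbb{R}_+=[0,\infty)$. A dislocated metric on a non-empty set $X$ is a function $d:X\times X\to\mathbb{R}_+$ such that for all $x,y,z\in X$: (i) $d(x,y)=d(y,x)$; (ii) $d(x,y)=0$ implies $x=y$; (iii) $d(x,y)\le d(x,z)+d(z,y)$. (The self-distance $d(x,x)$ is not required to be zero.) Then $(X,d)$ is called a dislocated metric space. A sequence $\{x_n\}$ in $X$ is $d$-Cauchy if for every $\varepsilon>0$ there is $n_0\in\mathbb{N}$ with $d(x_m,x_n)<\varepsilon$ for all $m,n\ge n_0$ (including $m=n$). A sequence $\{x_n\}$ converges to $x\in X$ with respect to $d$ if $\lim_{n\to\infty}d(x_n,x)=0$. $(X,d)$ is complete if every $d$-Cauchy sequence converges with respect to $d$ to some point of $X$. The class $\mathcal{A}_d$ consists of all functions $\alpha:\mathbb{R}_+^3\to\mathbb{R}_+$ such that: (A1) $\alpha$ is continuous on $\mathbb{R}_+^3$; (A2) there exists a constant $k_\alpha\in[0,1)$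 such that, for all $a,b\in\mathbb{R}_+$, whenever $a\le\alpha(a,b,b)$ or $a\le\alpha(b,a,b)$ or $a\le\alpha(b,b,a)$, then $a\le k_\alpha b$. *)

theory Defs
  imports "HOL-Analysis.Analysis" "HOL-Library.FuncSet"
begin

text \<open>
  The self-distance \<open>d x x\<close> need not vanish, so this is more general than
  \<^locale>\<open>Metric_space\<close>. As in that locale, nothing is required of \<open>d\<close> outside
  the carrier.
\<close>

locale dislocated_metric_space =
  fixes X :: "'a set" and d :: "'a \<Rightarrow> 'a \<Rightarrow> real"
  assumes carrier_nonempty: "X \<noteq> {}"
    and nonneg: "\<lbrakk>x \<in> X; y \<in> X\<rbrakk> \<Longrightarrow> 0 \<le> d x y"
    and commute: "\<lbrakk>x \<in> X; y \<in> X\<rbrakk> \<Longrightarrow> d x y = d y x"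
    and zero_imp_eq: "\<lbrakk>x \<in> X; y \<in> X; d x y = 0\<rbrakk> \<Longrightarrow> x = y"
    and triangle: "\<lbrakk>x \<in> X; y \<in> X; z \<in> X\<rbrakk> \<Longrightarrow> d x y \<le> d x z + d z y"
begin

definition d_Cauchy :: "(nat \<Rightarrow> 'a) \<Rightarrow> bool" where
  "d_Cauchy s \<longleftrightarrow> range s \<subseteq> X \<and> (\<forall>\<epsilon>>0. \<exists>n0. \<forall>m\<ge>n0. \<forall>n\<ge>n0. d (s m) (s n) < \<epsilon>)"

definition d_converges :: "(nat \<Rightarrow> 'a) \<Rightarrow> 'a \<Rightarrow> bool" where
  "d_converges s x \<longleftrightarrow> range s \<subseteq> X \<and> x \<in> X \<and> (\<lambda>n. d (s n) x) \<longlonglongrightarrow> 0"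

definition d_complete :: bool where
  "d_complete \<longleftrightarrow> (\<forall>s. d_Cauchy s \<longrightarrow> (\<exists>x. d_converges s x))"

end

locale complete_dislocated_metric_space = dislocated_metric_space +
  assumes complete: d_complete

text \<open>
  The class \<open>\<A>\<^sub>d\<close>. Its members are total functions on triples of reals, of which
  only the restriction to the nonnegative octant matters.
\<close>

definition class_Ad :: "(real \<times> real \<times> real \<Rightarrow> real) set" where
  "class_Ad = {\<alpha>.
     \<alpha> \<in> {0..} \<times> {0..} \<times> {0..} \<rightarrow> {0..} \<and>
     continuous_on ({0..} \<times> {0..} \<times> {0..}) \<alpha> \<and>
     (\<exists>k. 0 \<le> k \<and> k < 1 \<and>
        (\<forall>a\<ge>0. \<forall>b\<ge>0.
           a \<le> \<alpha> (a, b, b) \<or> a \<le> \<alpha> (b, a, b) \<or> a \<le> \<alpha> (b, b, a) \<longrightarrow> a \<le> k * b))}"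

end

theory Submission imports Defs begin

text \<open>
  Iterate \<open>x\<^sub>n\<^sub>+\<^sub>1 = f\<^sub>n\<^sub>+\<^sub>1 x\<^sub>n\<close> from any point. With \<open>a = d(x\<^sub>n\<^sub>+\<^sub>1, x\<^sub>n\<^sub>+\<^sub>2)\<close> and
  \<open>b = d(x\<^sub>n, x\<^sub>n\<^sub>+\<^sub>1)\<close> the hypothesis reads \<open>a \<le> \<alpha>(b, b, a)\<close>, so consecutive
  distances decay geometrically and the sequence converges to some \<open>z\<close>. Letting
  \<open>n \<rightarrow> \<infinity>\<close> in the bound on \<open>d(f\<^sub>i z, f\<^sub>n\<^sub>+\<^sub>1 x\<^sub>n)\<close> gives
  \<open>d(f\<^sub>i z, z) \<le> \<alpha>(0, d(z, f\<^sub>i z), 0)\<close>, which forces \<open>f\<^sub>i z = z\<close>. For fixed points the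
  hypothesis gives \<open>d(z, z) \<le> \<alpha>(a, a, a)\<close> with \<open>a = d(z, z)\<close>, hence \<open>d(z, z) = 0\<close>, and
  then \<open>d(z, w) \<le> \<alpha>(d(z, w), 0, 0)\<close>, hence \<open>z = w\<close>.
\<close>

context dislocated_metric_space
begin

text \<open>The triangle inequality bounds distances by sums of consecutive ones, hence by tails of
  a geometric series.\<close>

lemma geometric_imp_Cauchy:
  assumes s: "\<And>n. s n \<in> X" and k: "0 \<le> k" "k < 1"
    and step: "\<And>n. d (s (Suc n)) (s (Suc (Suc n))) \<le> k * d (s n) (s (Suc n))"
  shows "d_Cauchy s"
proof -
  \<comment> \<open>The sum of the whole series, so that \<open>k ^ m * C\<close> is its tail from
    \<open>m\<close>.\<close>
  define C where "C = d (s 0) (s 1) / (1 - k)"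
  have C: "0 \<le> C" using k nonneg[OF s s] by (simp add: C_def)
  have D: "d (s n) (s (Suc n)) \<le> k ^ n * C * (1 - k)" for n
  proof (induction n)
    case 0
    show ?case using k by (simp add: C_def)
  next
    case (Suc n)
    then show ?case using step[of n] mult_left_mono[OF Suc k(1)] by (simp add: mult.assoc)
  qed
  \<comment> \<open>The offset starts at 1 because \<open>d (s m) (s m)\<close> need not vanish. The
    first step is split off, so \<open>m\<close> must vary in the induction.\<close>
  have far: "d (s m) (s (m + Suc p)) \<le> k ^ m * C" for m p
  proof (induction p arbitrary: m)
    case 0
    have "k ^ m * C * (1 - k) \<le> k ^ m * C"
      using k C by (intro mult_right_le_one_le) auto
    then show ?case using D[of m] by simp
  next
    case (Suc p)
    have "d (s m) (s (m + Suc (Suc p)))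
        \<le> d (s m) (s (Suc m)) + d (s (Suc m)) (s (Suc m + Suc p))"
      using triangle[OF s s s, of m "m + Suc (Suc p)" "Suc m"] by simp
    also have "\<dots> \<le> k ^ m * C * (1 - k) + k ^ Suc m * C"
      using D[of m] Suc[of "Suc m"] by linarith
    also have "\<dots> = k ^ m * C" by (simp add: algebra_simps)
    finally show ?case .
  qed
  have bound: "d (s m) (s n) \<le> 2 * (k ^ m * C)" if "m \<le> n" for m n
  proof (cases "m = n")
    case True
    \<comment> \<open>The self-distance is only controlled through a detour.\<close>
    then show ?thesis
      using triangle[OF s s s, of m m "Suc m"] commute[OF s s, of m "Suc m"] far[of m 0] by simp
  next
    case False
    then have "m + Suc (n - Suc m) = n" using that by simp
    then have "d (s m) (s n) \<le> k ^ m * C" using far[of m "n - Suc m"] by simp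
    moreover have "0 \<le> k ^ m * C" using k C by simp
    ultimately show ?thesis by linarith
  qed
  have "\<exists>n0. \<forall>m\<ge>n0. \<forall>n\<ge>n0. d (s m) (s n) < e" if "e > 0" for e
  proof -
    have "(\<lambda>n. 2 * (k ^ n * C)) \<longlonglongrightarrow> 2 * (0 * C)"
      using k by (intro tendsto_intros LIMSEQ_realpow_zero) auto
    then have "\<forall>\<^sub>F n in sequentially. 2 * (k ^ n * C) < e"
      using that by (intro order_tendstoD) auto
    then obtain N where N: "\<And>n. n \<ge> N \<Longrightarrow> 2 * (k ^ n * C) < e"
      by (auto simp: eventually_sequentially)
    have "d (s m) (s n) < e" if "m \<ge> N" "n \<ge> N" for m n
      using bound[of m n] bound[of n m] N[of m] N[of n] commute[OF s s, of m n] that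
      by (cases "m \<le> n") auto
    then show ?thesis by blast
  qed
  then show ?thesis using s by (auto simp: d_Cauchy_def)
qed

text \<open>Two triangle inequalities, through \<open>z\<close> and through \<open>s n\<close>,
  bound the error by \<open>d (s n) z\<close>; no self-distance enters.\<close>

lemma d_converges_dist:
  assumes "d_converges s z" and u: "u \<in> X"
  shows "(\<lambda>n. d u (s n)) \<longlonglongrightarrow> d u z"
proof -
  have s: "\<And>n. s n \<in> X" and z: "z \<in> X" and lim: "(\<lambda>n. d (s n) z) \<longlonglongrightarrow> 0"
    using assms(1) by (auto simp: d_converges_def)
  have "\<bar>d u (s n) - d u z\<bar> \<le> d (s n) z" for n
    using triangle[OF u s z, of n] triangle[OF u z s, of n] commute[OF s z, of n] by linarith
  then have "(\<lambda>n. d u (s n) - d u z) \<longlonglongrightarrow> 0"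
    by (intro Lim_null_comparison[OF _ lim]) simp
  then show ?thesis by (rule LIM_zero_cancel)
qed

end

theorem theorem3p7:
  fixes X :: "'a set" and d :: "'a \<Rightarrow> 'a \<Rightarrow> real" and f :: "nat \<Rightarrow> 'a \<Rightarrow> 'a"
  assumes "complete_dislocated_metric_space X d"
    and "\<And>n. n \<ge> 1 \<Longrightarrow> f n \<in> X \<rightarrow> X"
    and "\<exists>\<alpha>\<in>class_Ad. \<forall>x\<in>X. \<forall>y\<in>X. \<forall>i\<ge>1. \<forall>j\<ge>1.
           d (f i x) (f j y) \<le> \<alpha> (d x y, d x (f i x), d y (f j y))"
  shows "(\<exists>!z. z \<in> X \<and> (\<forall>n\<ge>1. f n z = z)) \<and>
         (\<forall>z\<in>X. (\<forall>n\<ge>1. f n z = z) \<longrightarrow> d z z = 0)"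
proof -
  interpret complete_dislocated_metric_space X d by fact
  have fX: "f n x \<in> X" if "n \<ge> 1" "x \<in> X" for n x using assms(2) that by auto
  obtain \<alpha> where \<alpha>: "\<alpha> \<in> class_Ad"
    and contr: "\<And>x y i j. \<lbrakk>x \<in> X; y \<in> X; i \<ge> 1; j \<ge> 1\<rbrakk> \<Longrightarrow>
      d (f i x) (f j y) \<le> \<alpha> (d x y, d x (f i x), d y (f j y))"
    using assms(3) by blast
  have cont: "continuous_on ({0..} \<times> {0..} \<times> {0..}) \<alpha>" using \<alpha> by (simp add: class_Ad_def)
  obtain k where k: "0 \<le> k" "k < 1"
    and "\<forall>a\<ge>0. \<forall>b\<ge>0.
      a \<le> \<alpha> (a, b, b) \<or> a \<le> \<alpha> (b, a, b) \<or> a \<le> \<alpha> (b, b, a) \<longrightarrow> a \<le> k * b"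
    using \<alpha> unfolding class_Ad_def mem_Collect_eq by (elim conjE exE)
  then have A2: "a \<le> k * b" if "a \<ge> 0" "b \<ge> 0"
    "a \<le> \<alpha> (a, b, b) \<or> a \<le> \<alpha> (b, a, b) \<or> a \<le> \<alpha> (b, b, a)" for a b
    using that by auto
  have self: "d z z = 0" if z: "z \<in> X" "\<forall>n\<ge>1. f n z = z" for z
  proof -
    have "d z z \<le> k * d z z"
      using contr[of z z 1 1] z A2[of "d z z" "d z z"] nonneg by simp
    then have "(1 - k) * d z z \<le> 0" by (simp add: algebra_simps)
    then show ?thesis using k nonneg[OF z(1) z(1)] by (simp add: mult_le_0_iff)
  qed
  have unique: "z = w"
    if z: "z \<in> X" "\<forall>n\<ge>1. f n z = z" and w: "w \<in> X" "\<forall>n\<ge>1. f n w = w" for z w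
  proof -
    \<comment> \<open>By \<open>self\<close> the last two arguments of \<open>\<alpha>\<close>
      vanish, so the first case of \<open>A2\<close> applies with b = 0.\<close>
    have "d z w \<le> k * 0"
      using contr[of z w 1 1] z w self A2[of "d z w" 0] nonneg by simp
    then show ?thesis using zero_imp_eq nonneg z w by (simp add: order_antisym)
  qed
  obtain x0 where x0: "x0 \<in> X" using carrier_nonempty by blast
  \<comment> \<open>The shift to \<open>Suc n\<close> keeps every index at least 1, where the
    hypotheses on \<open>f\<close> hold.\<close>
  define x where "x = rec_nat x0 (\<lambda>n y. f (Suc n) y)"
  have x_Suc: "x (Suc n) = f (Suc n) (x n)" for n by (simp add: x_def)
  have x: "x n \<in> X" for n
    by (induction n) (auto simp: x_Suc fX, simp add: x_def x0)
  have "d (x (Suc n)) (x (Suc (Suc n))) \<le> k * d (x n) (x (Suc n))" for n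
    using contr[OF x x, of "Suc n" "Suc (Suc n)" n "Suc n"] x
    by (intro A2 nonneg) (auto simp flip: x_Suc)
  then have "d_Cauchy x" by (rule geometric_imp_Cauchy[OF x k])
  then obtain z where conv: "d_converges x z" using complete d_complete_def by blast
  then have z: "z \<in> X" and lim: "(\<lambda>n. d (x n) z) \<longlonglongrightarrow> 0" by (auto simp: d_converges_def)
  have lim_step: "(\<lambda>n. d (x n) (x (Suc n))) \<longlonglongrightarrow> 0"
  proof (rule tendsto_sandwich[OF _ _ tendsto_const])
    show "\<forall>\<^sub>F n in sequentially. 0 \<le> d (x n) (x (Suc n))" using x nonneg by simp
    show "\<forall>\<^sub>F n in sequentially. d (x n) (x (Suc n)) \<le> d (x n) z + d (x (Suc n)) z"
      using triangle[OF x x z] commute[OF x z] by simp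
    show "(\<lambda>n. d (x n) z + d (x (Suc n)) z) \<longlonglongrightarrow> 0"
      using tendsto_add[OF lim LIMSEQ_Suc[OF lim]] by simp
  qed
  have "f i z = z" if i: "i \<ge> 1" for i
  proof -
    have fz: "f i z \<in> X" using fX i z by simp
    \<comment> \<open>The index \<open>i\<close> stays fixed while the other one,
      \<open>Suc n\<close>, runs along the iteration.\<close>
    have "d (f i z) (x (Suc n)) \<le> \<alpha> (d (x n) z, d z (f i z), d (x n) (x (Suc n)))" for n
      using contr[OF z x i, of "Suc n" n] commute[OF x z, of n] by (simp flip: x_Suc)
    moreover have "(\<lambda>n. d (f i z) (x (Suc n))) \<longlonglongrightarrow> d (f i z) z"
      by (rule LIMSEQ_Suc) (rule d_converges_dist[OF conv fz])
    moreover have "(\<lambda>n. \<alpha> (d (x n) z, d z (f i z), d (x n) (x (Suc n))))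
        \<longlonglongrightarrow> \<alpha> (0, d z (f i z), 0)"
      \<comment> \<open>Continuity is given only on the octant, so nonnegativity puts the triples
        and their limit there.\<close>
      by (rule continuous_on_tendsto_compose[OF cont])
        (use lim lim_step nonneg x z fz in \<open>auto intro!: tendsto_Pair\<close>)
    ultimately have "d (f i z) z \<le> \<alpha> (0, d z (f i z), 0)"
      by (intro LIMSEQ_le) auto
    then have "d (f i z) z \<le> k * 0"
      using fz z nonneg commute[OF fz z] by (intro A2) auto
    then show ?thesis using zero_imp_eq nonneg fz z by (simp add: order_antisym)
  qed
  then show ?thesis using z unique self by blast
qed

end
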